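(* Let $\mathbf{c},\mathbf{v}_0\in\mathbb{R}^d$ with $\mathbf{c}>0$ and $\mathbf{v}_0>0$ (componentwise), and let $f(\mathbf{x}):=e^{\mathbf{c}^{\top}\mathbf{x}}-1$. For $u>0$ let $Q_u:=\mathbf{v}_0+u[0,1]^d$ and $F:=\max_{\mathbf{x}\in Q_u}f(\mathbf{x})=f(\mathbf{v}_0+u\mathbf{1})=e^{\mathbf{c}^{\top}\mathbf{v}_0}e^{u\mathbf{c}^{\top}\mathbf{1}}-1$. Then $$\lim_{u\to\infty}u^d\cdot\frac{\Delta(P^0,P)}{\operatorname{vol}(P^0(f,Q_u,\operatorname{conc}(f)))}=\lim_{u\to\infty}u^d\cdot\frac{(d+1)\,\Delta(P^0,P)}{\operatorname{vol}(P^0(f,Q_u,F))}=\frac{d+1}{\prod_{j=1}^d c_j}.$$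
   Context: $\mathbf{1}$ is the all-ones vector. $\operatorname{conc}(f)$ denotes the concave envelope of $f$ over $Q_u$, i.e., the smallest concave function on $Q_u$ that is $\ge f$ on $Q_u$. For a concave upper bound $\mu$ of $f$ on a polytope $Q\subset\mathbb{R}^d_{\ge0}\setminus\{\mathbf{0}\}$ (a concave function $\mu:Q\to\mathbb{R}$ with $\mu\ge f$ on $Q$), put $\tilde f(\mathbf{x},z):=zf(\mathbf{x}/z)$ and $\tilde\mu(\mathbf{x},z):=z\mu(\mathbf{x}/z)$ for $z>0$, $\mathbf{x}\in z\cdot Q$, and (closure convention) $\tilde\mu(\mathbf{0},0):=0$. The perspective relaxation is $$P(f,Q):=\operatorname{convcl}\{(\mathbf{x},y,z)\in\mathbb{R}^d\times\mathbb{R}\times\mathbb{R}:\ \tilde\mu(\mathbf{x},z)\ge y\ge\tilde f(\mathbf{x},z),\ \mathbf{x}\in z\cdot Q,\ 1\ge z>0\}$$ ($\operatorname{convcl}$ is the closure of the convex hull), and the naïve relaxation is $$P^0(f,Q)=P^0(f,Q,\mu):=\{(\mathbf{x},y,z)\in\mathbb{R}^d\times\mathbb{R}\times\mathbb{R}:\ \tilde\mu(\mathbf{x},z)\ge y\ge f(\mathbf{x}),\ \mathbf{x}\in z\cdot Q,\ 1\ge z\ge 0\}.$$ $\operatorname{vol}$ denotes Lebesgue measure in $\mathbb{R}^{d+2}$. $\Delta(P^0,P):=\operatorname{vol}(P^0(f,Q_u))-\operatorname{vol}(P(f,Q_u))$, where both relaxations use the same upper bound $\mu$, taken to be the one in the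 corresponding denominator (the value of $\Delta(P^0,P)$ does not depend on $\mu$). In $P^0(f,Q_u,F)$ the upper bound is the constant function $F$. *)

theory Defs
  imports "HOL-Analysis.Analysis"
begin

(* Concave envelope of f over S as the pointwise infimum of all concave majorants. By the lemma
   below this is the smallest concave majorant whenever S is convex and f is bounded above on S;
   values outside S are irrelevant. *)
definition conc :: "('a::real_vector \<Rightarrow> real) \<Rightarrow> 'a set \<Rightarrow> 'a \<Rightarrow> real" where
  "conc f S x = Inf {h x |h. concave_on S h \<and> (\<forall>y\<in>S. f y \<le> h y)}"

lemma conc_smallest_concave_majorant:
  fixes f :: "'a::real_vector \<Rightarrow> real"
  assumes S: "convex S" and bdd: "bdd_above (f ` S)"
  shows "concave_on S (conc f S)"
    and "\<forall>x\<in>S. f x \<le> conc f S x"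
    and "\<And>h. concave_on S h \<Longrightarrow> \<forall>x\<in>S. f x \<le> h x \<Longrightarrow> \<forall>x\<in>S. conc f S x \<le> h x"
proof -
  let ?M = "\<lambda>x. {h x |h. concave_on S h \<and> (\<forall>y\<in>S. f y \<le> h y)}"
  obtain B where B: "\<forall>y\<in>S. f y \<le> B"
    using bdd by (auto simp: bdd_above_def)
  have "concave_on S (\<lambda>x. B)"
    using S unfolding concave_on_iff by (metis distrib_right mult_1 order_refl)
  then have ne: "?M x \<noteq> {}" for x
    using B by auto
  have lower: "f x \<le> conc f S x" if "x \<in> S" for x
    unfolding conc_def using that by (intro cInf_greatest ne) auto
  have bdd_M: "bdd_below (?M x)" if "x \<in> S" for x
    using that by (intro bdd_belowI[where m = "f x"]) auto
  have least: "conc f S x \<le> h x" if "concave_on S h" "\<forall>y\<in>S. f y \<le> h y" "x \<in> S" for h x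
    unfolding conc_def using that by (intro cInf_lower bdd_M) auto
  show "\<forall>x\<in>S. f x \<le> conc f S x"
    using lower by blast
  show "\<forall>x\<in>S. conc f S x \<le> h x" if "concave_on S h" "\<forall>x\<in>S. f x \<le> h x" for h
    using least that by blast
  show "concave_on S (conc f S)"
    unfolding concave_on_iff
  proof (intro conjI S ballI allI impI)
    fix x y and s t :: real
    assume xy: "x \<in> S" "y \<in> S" and st: "0 \<le> s" "0 \<le> t" "s + t = 1"
    show "s * conc f S x + t * conc f S y \<le> conc f S (s *\<^sub>R x + t *\<^sub>R y)"
      unfolding conc_def[of f S "s *\<^sub>R x + t *\<^sub>R y"]
    proof (intro cInf_greatest ne)
      fix r assume "r \<in> ?M (s *\<^sub>R x + t *\<^sub>R y)"
      then obtain h where h: "concave_on S h" "\<forall>y\<in>S. f y \<le> h y"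
        and r: "r = h (s *\<^sub>R x + t *\<^sub>R y)"
        by blast
      have "s * conc f S x + t * conc f S y \<le> s * h x + t * h y"
        using least[OF h] xy st by (intro add_mono mult_left_mono) auto
      also have "\<dots> \<le> r"
        using h(1) xy st unfolding r concave_on_iff by blast
      finally show "s * conc f S x + t * conc f S y \<le> r" .
    qed
  qed
qed

(* The value 0 at z = 0 is the closure convention. *)
definition perspective :: "('a::real_vector \<Rightarrow> real) \<Rightarrow> 'a \<Rightarrow> real \<Rightarrow> real" where
  "perspective g x z = (if z = 0 then 0 else z * g (x /\<^sub>R z))"

(* In both relaxations mu is meant to be a concave upper bound of f on the polytope Q. *)
definition perspective_relaxation ::
  "('a::real_normed_vector \<Rightarrow> real) \<Rightarrow> 'a set \<Rightarrow> ('a \<Rightarrow> real) \<Rightarrow> ('a \<times> real \<times> real) set" where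
  "perspective_relaxation f Q \<mu> = closure (convex hull
     {(x, y, z). perspective f x z \<le> y \<and> y \<le> perspective \<mu> x z \<and>
                 x \<in> (\<lambda>q. z *\<^sub>R q) ` Q \<and> 0 < z \<and> z \<le> 1})"

definition naive_relaxation ::
  "('a::real_vector \<Rightarrow> real) \<Rightarrow> 'a set \<Rightarrow> ('a \<Rightarrow> real) \<Rightarrow> ('a \<times> real \<times> real) set" where
  "naive_relaxation f Q \<mu> =
     {(x, y, z). f x \<le> y \<and> y \<le> perspective \<mu> x z \<and>
                 x \<in> (\<lambda>q. z *\<^sub>R q) ` Q \<and> 0 \<le> z \<and> z \<le> 1}"

definition relaxation_gap ::
  "('a::euclidean_space \<Rightarrow> real) \<Rightarrow> 'a set \<Rightarrow> ('a \<Rightarrow> real) \<Rightarrow> real" where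
  "relaxation_gap f Q \<mu> =
     measure lebesgue (naive_relaxation f Q \<mu>) - measure lebesgue (perspective_relaxation f Q \<mu>)"

end

theory Submission imports Defs begin

text \<open>
  Write \<open>d\<close> for the dimension, \<open>M = exp (c \<bullet> (v0 + u 1))\<close> for the largest value of
  \<open>f + 1\<close> on \<open>Q u\<close>, and \<open>P\<close> for the product of the \<open>c $ j\<close>. For \<open>K\<close> in
  \<open>\<real>\<^sup>d \<times> \<real>\<close> let \<open>persp_cone K\<close> be the union of the sets \<open>z K \<times> {z}\<close> over \<open>0 < z \<le> 1\<close>; its
  volume is \<open>vol K / (d + 2)\<close> (\<open>measure_persp_cone\<close>).

  For a concave \<open>\<mu> \<ge> f \<ge> 0\<close> on \<open>Q\<close> let \<open>T\<close> be the cone over the region \<open>0 \<le> y \<le> \<mu> q\<close>, \<open>q \<in> Q\<close>.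
  Since \<open>f\<close> is convex and \<open>f 0 = 0\<close>, both relaxations are subsets of \<open>T\<close>, up to null sets. The
  perspective relaxation is \<open>T\<close> minus the cone over \<open>0 \<le> y < f q\<close>, and the naive relaxation is
  \<open>T\<close> minus the set \<open>cone_under f Q\<close> of points of the cone with \<open>0 \<le> y < f x\<close>. All these sets are
  convex or differences of convex sets, so measurability needs no regularity of \<open>\<mu>\<close>. Hence
  (\<open>relaxation_volumes\<close>), with \<open>b = vol (cone_under f Q)\<close>,
  \<open>gap = (\<integral>\<^sub>Q f) / (d + 2) - b\<close> for every \<open>\<mu>\<close>, and the naive relaxation has volume
  \<open>(\<integral>\<^sub>Q \<mu>) / (d + 2) - b\<close>.

  Slicing \<open>cone_under f Q\<close> at height \<open>z\<close> gives \<open>b \<le> M / (ln M \<cdot> P)\<close>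
  (\<open>measure_cone_under_exp_le\<close>), which is negligible against \<open>M\<close>. The integral of \<open>f\<close> over the box
  is a product of one-dimensional integrals and is asymptotic to \<open>M / P\<close>, so
  \<open>gap / M\<close> tends to \<open>1 / ((d + 2) P)\<close>. For \<open>\<mu> = F\<close> the naive volume divided by \<open>M u^d\<close> tends to
  \<open>1 / (d + 2)\<close>.

  For \<open>\<mu> = conc f\<close> an exact formula is not needed: in the coordinates \<open>x = v0 + u t\<close>,
  \<open>F min\<^sub>j t\<^sub>j \<le> conc f x \<le> M (min\<^sub>j t\<^sub>j + \<epsilon>)\<close>, where \<open>\<epsilon>\<close> is the sum of the
  \<open>exp (- u c\<^sub>j)\<close>. The lower bound holds because \<open>x\<close> lies on a segment from the top vertex
  \<open>v0 + u 1\<close> to another point of the box with weight \<open>min\<^sub>j t\<^sub>j\<close> on the vertex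
  (\<open>corner_le_concave\<close>); the upper one because \<open>f\<close> lies below \<open>d\<close> explicit affine functions
  (\<open>exp_le_affine\<close>). The region under \<open>h min\<^sub>j t\<^sub>j\<close> has volume \<open>u^d h / (d + 1)\<close>
  (\<open>measure_corner\<close>), so the naive volume divided by \<open>M u^d\<close> tends to
  \<open>1 / ((d + 1) (d + 2))\<close>. Both limits follow by division.
\<close>

section \<open>Slices of Lebesgue measure and the volume of a cone\<close>

lemma emeasure_lborel_slices:
  fixes A :: "('a::euclidean_space \<times> 'b::euclidean_space) set"
  assumes "A \<in> sets borel"
  shows "emeasure lborel A = (\<integral>\<^sup>+x. emeasure lborel (Pair x -` A) \<partial>lborel)"
proof -
  have "A \<in> sets (lborel \<Otimes>\<^sub>M lborel)"
    using assms by (simp only: lborel_prod sets_lborel)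
  then show ?thesis
    using lborel.emeasure_pair_measure_alt[of A lborel] by (simp add: lborel_prod)
qed

lemma emeasure_lborel_slices_third:
  fixes A :: "('a::euclidean_space \<times> real \<times> real) set"
  assumes A: "A \<in> sets borel"
  shows "emeasure lborel A = (\<integral>\<^sup>+z. emeasure lborel {(x, y). (x, y, z) \<in> A} \<partial>lborel)"
proof -
  have m: "(\<lambda>(p, z). indicator A (fst p, snd p, z) :: ennreal)
      \<in> borel_measurable ((lborel \<Otimes>\<^sub>M lborel) \<Otimes>\<^sub>M lborel)"
    unfolding lborel_prod measurable_lborel2 split_def
    by (intro measurable_compose[OF _ borel_measurable_indicator[OF A]]
        borel_measurable_continuous_onI continuous_intros)
  have "emeasure lborel A = (\<integral>\<^sup>+x. emeasure lborel (Pair x -` A) \<partial>lborel)"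
    by (rule emeasure_lborel_slices[OF A])
  also have "\<dots> = (\<integral>\<^sup>+x. (\<integral>\<^sup>+y. (\<integral>\<^sup>+z. indicator A (x, y, z) \<partial>lborel) \<partial>lborel) \<partial>lborel)"
  proof (intro nn_integral_cong)
    fix x :: 'a
    have P: "Pair x -` A \<in> sets borel"
      using A by (simp add: measurable_sets_borel[of "Pair x" borel])
    have "emeasure lborel (Pair x -` A) = (\<integral>\<^sup>+y. emeasure lborel (Pair y -` Pair x -` A) \<partial>lborel)"
      by (rule emeasure_lborel_slices[OF P])
    also have "\<dots> = (\<integral>\<^sup>+y. (\<integral>\<^sup>+z. indicator A (x, y, z) \<partial>lborel) \<partial>lborel)"
    proof (intro nn_integral_cong)
      fix y :: real
      have "Pair y -` Pair x -` A \<in> sets borel"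
        using P by (simp add: measurable_sets_borel[of "Pair y" borel])
      moreover have "(\<lambda>z. indicator A (x, y, z) :: ennreal) = indicator (Pair y -` Pair x -` A)"
        by (auto simp: indicator_def)
      ultimately show "emeasure lborel (Pair y -` Pair x -` A) = (\<integral>\<^sup>+z. indicator A (x, y, z) \<partial>lborel)"
        by simp
    qed
    finally show "emeasure lborel (Pair x -` A) = \<dots>" .
  qed
  also have "\<dots> = (\<integral>\<^sup>+p. (\<integral>\<^sup>+z. indicator A (fst p, snd p, z) \<partial>lborel) \<partial>(lborel \<Otimes>\<^sub>M lborel))"
    using lborel.nn_integral_fst[OF lborel.borel_measurable_nn_integral[OF m]] by simp
  also have "\<dots> = (\<integral>\<^sup>+z. (\<integral>\<^sup>+p. indicator A (fst p, snd p, z) \<partial>(lborel \<Otimes>\<^sub>M lborel)) \<partial>lborel)"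
    unfolding lborel_prod
  proof (rule lborel_pair.Fubini'[symmetric])
    show "(\<lambda>(p, z). indicator A (fst p, snd p, z) :: ennreal) \<in> borel_measurable (lborel \<Otimes>\<^sub>M lborel)"
      using m unfolding lborel_prod .
  qed
  also have "\<dots> = (\<integral>\<^sup>+z. emeasure lborel {(x, y). (x, y, z) \<in> A} \<partial>lborel)"
    unfolding lborel_prod
  proof (intro nn_integral_cong)
    fix z :: real
    have "(\<lambda>p::'a \<times> real. (fst p, snd p, z)) -` A \<in> sets borel"
      by (rule measurable_sets_borel[OF _ A]) (intro borel_measurable_continuous_onI continuous_intros)
    then have "{(x, y). (x, y, z) \<in> A} \<in> sets borel"
      by (simp add: vimage_def split_def)
    moreover have "(\<lambda>p. indicator A (fst p, snd p, z) :: ennreal) = indicator {(x, y). (x, y, z) \<in> A}"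
      by (auto simp: indicator_def)
    ultimately show "(\<integral>\<^sup>+p. indicator A (fst p, snd p, z) \<partial>lborel) = emeasure lborel {(x, y). (x, y, z) \<in> A}"
      by simp
  qed
  finally show ?thesis .
qed

text \<open>
  The cone with apex \<open>0\<close> over \<open>K \<times> {1}\<close>, without its apex. The coordinates are ordered
  \<open>(x, y, z)\<close> as in the relaxations, so that the base \<open>K\<close> collects the pairs \<open>(x / z, y / z)\<close>.
\<close>

definition persp_cone :: "('a::real_vector \<times> real) set \<Rightarrow> ('a \<times> real \<times> real) set" where
  "persp_cone K = {(x, y, z). 0 < z \<and> z \<le> 1 \<and> (x /\<^sub>R z, y / z) \<in> K}"

lemma persp_cone_borel:
  fixes K :: "('a::euclidean_space \<times> real) set"
  assumes K: "K \<in> sets borel"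
  shows "persp_cone K \<in> sets borel"
proof -
  have "(\<lambda>p::'a \<times> real \<times> real. (fst p /\<^sub>R snd (snd p), fst (snd p) / snd (snd p))) -` K \<in> sets borel"
    by (intro measurable_sets_borel[OF _ K], unfold borel_prod[symmetric]) measurable
  moreover have "(\<lambda>p::'a \<times> real \<times> real. snd (snd p)) -` {0<..1} \<in> sets borel"
    by (rule measurable_sets_borel[where M = borel], intro borel_measurable_continuous_onI continuous_intros) simp
  moreover have "persp_cone K = (\<lambda>p. snd (snd p)) -` {0<..1} \<inter>
      (\<lambda>p. (fst p /\<^sub>R snd (snd p), fst (snd p) / snd (snd p))) -` K"
    by (auto simp: persp_cone_def)
  ultimately show ?thesis
    by (simp only: sets.Int)
qed

lemma emeasure_persp_cone:
  fixes K :: "('a::euclidean_space \<times> real) set"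
  assumes K: "K \<in> sets borel"
  shows "emeasure lborel (persp_cone K) = ennreal (1 / (real DIM('a) + 2)) * emeasure lborel K"
proof -
  let ?n = "DIM('a) + 1"
  have slice: "emeasure lborel {(x, y). (x, y, z) \<in> persp_cone K}
      = emeasure lborel K * (ennreal (z ^ ?n) * indicator {0..1} z)" for z :: real
  proof (cases "0 < z \<and> z \<le> 1")
    case True
    have "{(x, y). (x, y, z) \<in> persp_cone K} = (\<lambda>p. z *\<^sub>R p + 0) ` K"
    proof (intro set_eqI iffI)
      fix p assume "p \<in> {(x, y). (x, y, z) \<in> persp_cone K}"
      then have "(fst p /\<^sub>R z, snd p / z) \<in> K"
        by (auto simp: persp_cone_def)
      moreover have "p = z *\<^sub>R (fst p /\<^sub>R z, snd p / z) + 0"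
        using True by (auto simp: prod_eq_iff)
      ultimately show "p \<in> (\<lambda>p. z *\<^sub>R p + 0) ` K" by blast
    next
      fix p assume "p \<in> (\<lambda>p. z *\<^sub>R p + 0) ` K"
      then show "p \<in> {(x, y). (x, y, z) \<in> persp_cone K}"
        using True by (auto simp: persp_cone_def)
    qed
    moreover have "(\<lambda>p. z *\<^sub>R p + 0) ` K = (\<lambda>p. (1/z) *\<^sub>R p) -` K"
      using True by (force simp: image_iff)
    moreover have "(\<lambda>p. (1/z) *\<^sub>R p) -` K \<in> sets borel"
      by (intro measurable_sets_borel[OF _ K]) simp
    moreover have "emeasure lebesgue ((\<lambda>p. z *\<^sub>R p + 0) ` K) = ennreal (\<bar>z\<bar> ^ DIM('a \<times> real)) * emeasure lebesgue K"
      using emeasure_lebesgue_affine[of z 0 K] K by simp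
    ultimately show ?thesis
      using True K by (simp add: mult.commute)
  next
    case False
    then have "{(x, y). (x, y, z) \<in> persp_cone K} = {}"
      by (auto simp: persp_cone_def)
    with False show ?thesis
      by (cases "z = 0") (auto simp: indicator_def)
  qed
  have "emeasure lborel (persp_cone K) = emeasure lborel K * (\<integral>\<^sup>+z. ennreal (z ^ ?n) * indicator {0..1} z \<partial>lborel)"
    unfolding emeasure_lborel_slices_third[OF persp_cone_borel[OF K]] slice
    by (rule nn_integral_cmult) measurable
  also have "(\<integral>\<^sup>+z. ennreal (z ^ ?n) * indicator {0..1} z \<partial>lborel)
     = ennreal (1 ^ Suc ?n / real (Suc ?n) - 0 ^ Suc ?n / real (Suc ?n))"
  proof (rule nn_integral_FTC_Icc)
    show "((\<lambda>z. z ^ Suc ?n / real (Suc ?n)) has_real_derivative z ^ ?n) (at z)" for z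
      by (rule derivative_eq_intros refl | simp del: of_nat_Suc power_Suc)+
  qed auto
  finally show ?thesis
    by (simp add: mult.commute add.commute add.assoc)
qed

section \<open>The relaxations as differences of convex cones\<close>

lemma convex_persp_cone:
  fixes K :: "('a::real_vector \<times> real) set"
  assumes K: "convex K"
  shows "convex (persp_cone K)"
  unfolding convex_def
proof (intro ballI allI impI)
  fix p q :: "'a \<times> real \<times> real" and a b :: real
  assume p: "p \<in> persp_cone K" and q: "q \<in> persp_cone K" and ab: "0 \<le> a" "0 \<le> b" "a + b = 1"
  obtain x y z x' y' z' where pq: "p = (x, y, z)" "q = (x', y', z')"
    by (metis surj_pair)
  define w where "w = a * z + b * z'"
  have z: "0 < z" "z \<le> 1" "(x /\<^sub>R z, y / z) \<in> K" "0 < z'" "z' \<le> 1" "(x' /\<^sub>R z', y' / z') \<in> K"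
    using p q by (auto simp: pq persp_cone_def)
  have w: "0 < w"
    using z ab unfolding w_def by (smt (verit) mult_pos_pos mult_nonneg_nonneg)
  have "w \<le> 1"
    using z ab unfolding w_def by (intro convex_bound_le) auto
  have "(a * z / w) *\<^sub>R (x /\<^sub>R z, y / z) + (b * z' / w) *\<^sub>R (x' /\<^sub>R z', y' / z') \<in> K"
    using z ab w by (intro convexD[OF K]) (auto simp: w_def simp flip: add_divide_distrib)
  also have "(a * z / w) *\<^sub>R (x /\<^sub>R z, y / z) + (b * z' / w) *\<^sub>R (x' /\<^sub>R z', y' / z')
      = ((a *\<^sub>R x + b *\<^sub>R x') /\<^sub>R w, (a * y + b * y') / w)"
  proof -
    have "a * z / w * inverse z = inverse w * a" "b * z' / w * inverse z' = inverse w * b"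
      using z by (simp_all add: divide_inverse)
    then show ?thesis
      using z by (simp add: scaleR_add_right add_divide_distrib)
  qed
  finally show "a *\<^sub>R p + b *\<^sub>R q \<in> persp_cone K"
    using w \<open>w \<le> 1\<close> by (simp add: pq persp_cone_def w_def)
qed

lemma persp_cone_mono: "K \<subseteq> L \<Longrightarrow> persp_cone K \<subseteq> persp_cone L"
  by (auto simp: persp_cone_def)

lemma bounded_persp_cone:
  fixes K :: "('a::real_normed_vector \<times> real) set"
  assumes "bounded K"
  shows "bounded (persp_cone K)"
proof -
  obtain R where R: "\<And>p. p \<in> K \<Longrightarrow> norm p \<le> R"
    using assms by (auto simp: bounded_iff)
  have "norm p \<le> R + 1" if pc: "p \<in> persp_cone K" for p
  proof -
    obtain x y z where p: "p = (x, y, z)"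
      by (metis surj_pair)
    have z: "0 < z" "z \<le> 1" "(x /\<^sub>R z, y / z) \<in> K"
      using pc by (auto simp: p persp_cone_def)
    have "norm (x, y) = z * norm (x /\<^sub>R z, y / z)"
      using z norm_scaleR[of z "(x /\<^sub>R z, y / z)"] by simp
    also have "\<dots> \<le> 1 * R"
      using z R by (intro mult_mono) auto
    finally have "norm (x, y) \<le> R" by simp
    have "norm p = norm ((x, y), z)"
      by (simp add: p norm_Pair)
    also have "\<dots> \<le> norm (x, y) + norm z"
      by (rule norm_Pair_le)
    finally show ?thesis
      using \<open>norm (x, y) \<le> R\<close> z by simp
  qed
  then show ?thesis unfolding bounded_iff by blast
qed

lemma measure_persp_cone:
  fixes K :: "('a::euclidean_space \<times> real) set"
  assumes K: "K \<in> sets borel"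
  shows "measure lebesgue (persp_cone K) = measure lebesgue K / (real DIM('a) + 2)"
proof -
  have "measure lborel (persp_cone K) = measure lborel K / (real DIM('a) + 2)"
    unfolding measure_def emeasure_persp_cone[OF K] by (simp add: enn2real_mult)
  then show ?thesis
    using K persp_cone_borel[OF K] by simp
qed

text \<open>
  The part of the cone over \<open>Q\<close> with \<open>0 \<le> y < f x\<close>; the bound is \<open>f x\<close> itself and not the
  perspective of \<open>f\<close>. For convex \<open>f \<ge> 0\<close> with \<open>f 0 = 0\<close> this is the part of the hypograph cone
  of an upper bound of \<open>f\<close> that the naive relaxation leaves out.
\<close>

definition cone_under :: "('a::real_vector \<Rightarrow> real) \<Rightarrow> 'a set \<Rightarrow> ('a \<times> real \<times> real) set" where
  "cone_under f Q = {(x, y, z). 0 < z \<and> z \<le> 1 \<and> x /\<^sub>R z \<in> Q \<and> 0 \<le> y \<and> y < f x}"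

lemma image_scaleR_iff:
  fixes x :: "'a::real_vector"
  shows "0 < z \<Longrightarrow> x \<in> (\<lambda>q. z *\<^sub>R q) ` Q \<longleftrightarrow> x /\<^sub>R z \<in> Q"
  by (force simp: image_iff)

text \<open>
  The gap does not involve \<open>\<mu>\<close>: passing from the hypograph cone \<open>T\<close> to either relaxation
  removes a set that depends on \<open>f\<close> and \<open>Q\<close> only.
\<close>

lemma relaxation_volumes:
  fixes f \<mu> :: "'a::euclidean_space \<Rightarrow> real"
  assumes f: "convex_on UNIV f" "f 0 = 0"
    and nonneg: "\<And>q z. q \<in> Q \<Longrightarrow> 0 \<le> z \<Longrightarrow> 0 \<le> f (z *\<^sub>R q)"
    and Q: "bounded Q" "Q \<noteq> {}"
    and mu: "concave_on Q \<mu>" "\<And>q. q \<in> Q \<Longrightarrow> f q \<le> \<mu> q" "\<And>q. q \<in> Q \<Longrightarrow> \<mu> q \<le> C"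
  defines "T \<equiv> persp_cone {(q, y). q \<in> Q \<and> 0 \<le> y \<and> y \<le> \<mu> q}"
  shows lmeasurable_hypograph_cone: "T \<in> lmeasurable"
    and lmeasurable_cone_under: "cone_under f Q \<in> lmeasurable"
    and measure_naive_relaxation:
      "measure lebesgue (naive_relaxation f Q \<mu>) = measure lebesgue T - measure lebesgue (cone_under f Q)"
    and relaxation_gap_eq:
      "relaxation_gap f Q \<mu> = measure lebesgue (persp_cone {(q, y). q \<in> Q \<and> 0 \<le> y \<and> y < f q})
          - measure lebesgue (cone_under f Q)"
proof -
  let ?B = "cone_under f Q" and ?L = "persp_cone {(q, y). q \<in> Q \<and> 0 \<le> y \<and> y < f q}"
  let ?S = "persp_cone {(q, y). q \<in> Q \<and> f q \<le> y \<and> y \<le> \<mu> q}"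
  let ?N = "persp_cone {(q, y). q \<in> Q \<and> y \<le> \<mu> q} \<inter> {(x, y, z). f x \<le> y}"
  \<comment> \<open>\<open>?S\<close> and \<open>?N\<close> are the perspective and the naive relaxation up to null sets; \<open>?L\<close> and
    \<open>?B\<close> are their complements in \<open>T\<close>.\<close>
  have shrink: "f (z *\<^sub>R q) \<le> z * f q" if "0 < z" "z \<le> 1" for z q
    using convex_onD[OF f(1), of z 0 q] that f(2) by simp
  have f_le: "f x \<le> y" if "0 < z" "z \<le> 1" "f (x /\<^sub>R z) \<le> y / z" for x y z
    using shrink[OF that(1,2), of "x /\<^sub>R z"] that by (simp add: field_simps)
  have f_nonneg: "0 \<le> f x" if "0 < z" "x /\<^sub>R z \<in> Q" for x z
    using nonneg[OF that(2), of z] that(1) by simp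
  have Qnonneg: "0 \<le> f q" if "q \<in> Q" for q
    using nonneg[OF that, of 1] by simp
  have hypo: "convex {(q, y). q \<in> Q \<and> y \<le> \<mu> q}"
  proof -
    have "{(q, y). q \<in> Q \<and> y \<le> \<mu> q} = (\<lambda>p. (fst p, - snd p)) -` epigraph Q (\<lambda>q. - \<mu> q)"
      by (auto simp: epigraph_def)
    also have "convex \<dots>"
      using mu(1) unfolding concave_on_def
      by (intro convex_linear_vimage convex_epigraphI) (auto simp: linear_iff)
    finally show ?thesis .
  qed
  have epi: "convex {(q::'a, y::real). f q \<le> y}"
    using convex_epigraphI[OF f(1)] by (simp add: epigraph_def split_def)
  have epi': "convex {(x::'a, y::real, z::real). f x \<le> y}"
  proof -
    have "{(x::'a, y::real, z::real). f x \<le> y} = (\<lambda>p. (fst p, fst (snd p))) -` {(q, y). f q \<le> y}"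
      by auto
    also have "convex \<dots>"
      by (intro convex_linear_vimage epi) (auto simp: linear_iff)
    finally show ?thesis .
  qed
  have half: "convex {(q::'a, y::real). 0 \<le> y}"
    by (auto simp: convex_def)
  have T: "T = persp_cone ({(q, y). q \<in> Q \<and> y \<le> \<mu> q} \<inter> {(q, y). 0 \<le> y})"
    unfolding T_def by (rule arg_cong[of _ _ persp_cone]) auto
  have S: "?S = persp_cone ({(q, y). q \<in> Q \<and> y \<le> \<mu> q} \<inter> {(q, y). f q \<le> y})"
    by (rule arg_cong[of _ _ persp_cone]) auto
  have "{(q, y). q \<in> Q \<and> 0 \<le> y \<and> y \<le> \<mu> q} \<subseteq> Q \<times> {0..C}"
    using mu(3) by force
  then have "bounded {(q, y). q \<in> Q \<and> 0 \<le> y \<and> y \<le> \<mu> q}"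
    using Q(1) bounded_Times bounded_closed_interval bounded_subset by blast
  then have bT: "bounded T"
    unfolding T_def by (rule bounded_persp_cone)
  have ST: "?S \<subseteq> T"
    unfolding T_def using Qnonneg by (intro persp_cone_mono) (auto intro: order_trans)
  have NT: "?N \<subseteq> T"
    unfolding T_def using f_nonneg by (auto simp: persp_cone_def intro!: divide_nonneg_pos dest: order_trans)
  have cS: "convex ?S"
    unfolding S by (intro convex_persp_cone convex_Int hypo epi)
  have mT: "T \<in> lmeasurable"
    using bT unfolding T by (intro measurable_convex convex_persp_cone convex_Int hypo half)
  have mS: "?S \<in> lmeasurable"
    by (intro measurable_convex cS bounded_subset[OF bT ST])
  have mN: "?N \<in> lmeasurable"
    by (intro measurable_convex convex_persp_cone convex_Int hypo epi' bounded_subset[OF bT NT])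
  have TS: "T - ?S = ?L"
    unfolding T_def using mu(2) by (auto simp: persp_cone_def not_le intro: order_trans[OF less_imp_le])
  have TN: "T - ?N = ?B"
  proof (intro set_eqI iffI)
    fix p assume "p \<in> T - ?N"
    then show "p \<in> ?B"
      by (auto simp: T_def persp_cone_def cone_under_def zero_le_divide_iff)
  next
    fix p assume "p \<in> ?B"
    then obtain x y z where p: "p = (x, y, z)" "0 < z" "z \<le> 1" "x /\<^sub>R z \<in> Q" "0 \<le> y" "y < f x"
      by (auto simp: cone_under_def)
    have "f x \<le> z * f (x /\<^sub>R z)"
      using shrink[of z "x /\<^sub>R z"] p by simp
    also have "\<dots> \<le> z * \<mu> (x /\<^sub>R z)"
      using p mu(2) by (intro mult_left_mono) auto
    finally show "p \<in> T - ?N"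
      using p by (auto simp: T_def persp_cone_def field_simps)
  qed
  show "T \<in> lmeasurable" by (rule mT)
  show mB: "?B \<in> lmeasurable"
    unfolding TN[symmetric] by (intro fmeasurable.Diff mT mN)
  have mL: "?L \<in> lmeasurable"
    unfolding TS[symmetric] by (intro fmeasurable.Diff mT mS)
  \<comment> \<open>At \<open>z = 0\<close> the naive relaxation contains the origin only.\<close>
  have "naive_relaxation f Q \<mu> = ?N \<union> {0}"
  proof (intro set_eqI iffI)
    fix p assume "p \<in> naive_relaxation f Q \<mu>"
    then obtain x y z where p: "p = (x, y, z)" and le: "f x \<le> y" "y \<le> perspective \<mu> x z"
      and x: "x \<in> (\<lambda>q. z *\<^sub>R q) ` Q" and z: "0 \<le> z" "z \<le> 1"
      by (auto simp: naive_relaxation_def)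
    show "p \<in> ?N \<union> {0}"
    proof (cases "z = 0")
      case True
      with x le show ?thesis by (auto simp: p perspective_def f(2) zero_prod_def)
    next
      case False
      with x le z show ?thesis
        by (auto simp: p perspective_def persp_cone_def field_simps)
    qed
  next
    fix p assume "p \<in> ?N \<union> {0}"
    then consider "p = (0, 0, 0)" | "p \<in> ?N" by (auto simp only: zero_prod_def Un_iff singleton_iff)
    then show "p \<in> naive_relaxation f Q \<mu>"
    proof cases
      case 1
      with Q(2) show ?thesis
        by (auto simp: naive_relaxation_def perspective_def f(2))
    next
      case 2
      then show ?thesis
        by (auto simp: naive_relaxation_def perspective_def persp_cone_def image_scaleR_iff field_simps)
    qed
  qed
  then have "measure lebesgue (naive_relaxation f Q \<mu>) = measure lebesgue ?N"
    using measure_Un_null_set[OF fmeasurableD[OF mN], of "{0}"]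
    by (simp only: negligible_sing flip: negligible_iff_null_sets)
  also have "measure lebesgue ?N = measure lebesgue (T - ?B)"
    using TN NT by (simp add: double_diff flip: TN)
  also have "\<dots> = measure lebesgue T - measure lebesgue ?B"
    using TN mT mB by (intro measurable_measure_Diff) auto
  finally show N: "measure lebesgue (naive_relaxation f Q \<mu>) = \<dots>" .
  have "perspective_relaxation f Q \<mu> = closure (convex hull ?S)"
    unfolding perspective_relaxation_def persp_cone_def
    by (intro arg_cong[of _ _ "\<lambda>X. closure (convex hull X)"])
      (auto simp: perspective_def image_scaleR_iff field_simps)
  then have "measure lebesgue (perspective_relaxation f Q \<mu>) = measure lebesgue ?S"
    using measure_closure[OF bounded_subset[OF bT ST] negligible_convex_frontier[OF cS]]
      hull_same[of convex, OF cS] by (simp only:)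
  also have "\<dots> = measure lebesgue (T - ?L)"
    using TS ST by (simp add: double_diff flip: TS)
  also have "\<dots> = measure lebesgue T - measure lebesgue ?L"
    using TS mT mL by (intro measurable_measure_Diff) auto
  finally show "relaxation_gap f Q \<mu> = measure lebesgue ?L - measure lebesgue ?B"
    using N unfolding relaxation_gap_def by simp
qed

section \<open>Volumes over boxes\<close>

lemma prod_Basis_cart:
  fixes g :: "real ^ 'n \<Rightarrow> 'b::comm_monoid_mult"
  shows "(\<Prod>i\<in>Basis. g i) = (\<Prod>j\<in>UNIV. g (axis j 1))"
proof -
  have basis: "Basis = range (\<lambda>j. axis j (1::real) :: real^'n)"
    by (auto simp: Basis_vec_def)
  have inj: "inj (\<lambda>j. axis j (1::real) :: real^'n)"
    by (auto intro!: injI simp: axis_eq_axis)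
  show ?thesis
    unfolding basis prod.reindex[OF inj] o_def ..
qed

lemma nn_integral_exp_cbox:
  fixes a b c :: "real ^ 'n"
  assumes c: "\<forall>j. 0 < c $ j" and ab: "\<forall>j. a $ j \<le> b $ j"
  shows "(\<integral>\<^sup>+x. ennreal (exp (c \<bullet> x)) * indicator (cbox a b) x \<partial>lborel)
    = ennreal (\<Prod>j\<in>UNIV. (exp (c $ j * b $ j) - exp (c $ j * a $ j)) / c $ j)"
proof -
  let ?g = "\<lambda>i t. ennreal (exp ((c \<bullet> i) * t)) * indicator {a \<bullet> i..b \<bullet> i} t"
  have ind: "(indicator (cbox a b) x :: ennreal) = (\<Prod>i\<in>Basis. indicator {a \<bullet> i..b \<bullet> i} (x \<bullet> i))" for x
    by (auto simp: indicator_def mem_box)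
  have "ennreal (exp (c \<bullet> x)) * indicator (cbox a b) x = (\<Prod>i\<in>Basis. ?g i (x \<bullet> i))" for x
    unfolding prod.distrib ind
    by (subst euclidean_inner) (simp add: exp_sum prod_ennreal)
  then have "(\<integral>\<^sup>+x. ennreal (exp (c \<bullet> x)) * indicator (cbox a b) x \<partial>lborel)
      = (\<integral>\<^sup>+x. (\<Prod>i\<in>Basis. ?g i (x \<bullet> i)) \<partial>lborel)"
    by simp
  also have "\<dots> = (\<Prod>i\<in>Basis. \<integral>\<^sup>+t. ?g i t \<partial>lborel)"
    by (rule nn_integral_lborel_prod) auto
  also have "\<dots> = (\<Prod>j\<in>UNIV. \<integral>\<^sup>+t. ?g (axis j 1) t \<partial>lborel)"
    by (rule prod_Basis_cart)
  also have "\<dots> = (\<Prod>j\<in>UNIV. ennreal ((exp (c $ j * b $ j) - exp (c $ j * a $ j)) / c $ j))"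
  proof (intro prod.cong refl)
    fix j :: 'n
    have cj: "c $ j > 0" using c by blast
    have "(\<integral>\<^sup>+t. ennreal (exp (c $ j * t)) * indicator {a $ j..b $ j} t \<partial>lborel)
        = ennreal (exp (c $ j * b $ j) / c $ j - exp (c $ j * a $ j) / c $ j)"
      using ab cj by (intro nn_integral_FTC_Icc) (auto intro!: derivative_eq_intros)
    then show "(\<integral>\<^sup>+t. ?g (axis j 1) t \<partial>lborel) = ennreal ((exp (c $ j * b $ j) - exp (c $ j * a $ j)) / c $ j)"
      by (simp add: inner_axis diff_divide_distrib)
  qed
  also have "\<dots> = ennreal (\<Prod>j\<in>UNIV. (exp (c $ j * b $ j) - exp (c $ j * a $ j)) / c $ j)"
    using c ab by (intro prod_ennreal) (auto intro!: divide_nonneg_pos mult_left_mono simp: less_imp_le)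
  finally show ?thesis .
qed

lemma borel_subgraph:
  fixes g :: "'a::euclidean_space \<Rightarrow> real"
  assumes A: "A \<in> sets borel" and g: "g \<in> borel_measurable borel"
  shows "{(x, y). x \<in> A \<and> 0 \<le> y \<and> y < g x} \<in> sets borel"
proof -
  have [measurable]: "A \<in> sets borel" "g \<in> borel_measurable borel"
    using assms by auto
  have "{p \<in> space (borel \<Otimes>\<^sub>M borel). fst p \<in> A \<and> 0 \<le> snd p \<and> snd p < g (fst p)} \<in> sets (borel \<Otimes>\<^sub>M borel)"
    by measurable
  then show ?thesis
    unfolding borel_prod by (simp add: split_def)
qed

lemma emeasure_subgraph:
  fixes g :: "'a::euclidean_space \<Rightarrow> real"
  assumes "A \<in> sets borel" "g \<in> borel_measurable borel"
  shows "emeasure lborel {(x, y). x \<in> A \<and> 0 \<le> y \<and> y < g x}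
    = (\<integral>\<^sup>+x. ennreal (g x) * indicator A x \<partial>lborel)"
proof -
  have "emeasure lborel (Pair x -` {(x, y). x \<in> A \<and> 0 \<le> y \<and> y < g x})
      = ennreal (g x) * indicator A x" for x
  proof (cases "x \<in> A")
    case True
    then have eq: "Pair x -` {(x, y). x \<in> A \<and> 0 \<le> y \<and> y < g x} = {0..<g x}"
      by auto
    show ?thesis
      unfolding eq using True by (cases "0 \<le> g x") (auto simp: ennreal_neg)
  qed simp
  then show ?thesis
    using emeasure_lborel_slices[OF borel_subgraph[OF assms]] by simp
qed

lemma measure_subgraph_exp:
  fixes a b c :: "real ^ 'n"
  assumes c: "\<forall>j. 0 < c $ j" and a: "\<forall>j. 0 \<le> a $ j" and ab: "\<forall>j. a $ j \<le> b $ j"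
  shows "measure lebesgue {(x, y). x \<in> cbox a b \<and> 0 \<le> y \<and> y < exp (c \<bullet> x) - 1}
    = (\<Prod>j\<in>UNIV. (exp (c $ j * b $ j) - exp (c $ j * a $ j)) / c $ j) - (\<Prod>j\<in>UNIV. b $ j - a $ j)"
    (is "measure lebesgue ?K = ?E - ?V")
proof -
  let ?X = "\<integral>\<^sup>+x. ennreal (exp (c \<bullet> x) - 1) * indicator (cbox a b) x \<partial>lborel"
  have ge: "1 \<le> exp (c \<bullet> x)" if "x \<in> cbox a b" for x
  proof -
    have "0 \<le> x $ j" for j
      using that a order_trans unfolding mem_box_cart by blast
    then show ?thesis
      using c by (simp add: inner_vec_def sum_nonneg less_imp_le)
  qed
  have box: "emeasure lborel (cbox a b) = ennreal ?V"
  proof -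
    have ne: "cbox a b \<noteq> {}"
      using ab by (simp add: interval_ne_empty_cart)
    have "emeasure lborel (cbox a b) = ennreal (measure lborel (cbox a b))"
      using emeasure_lborel_cbox_finite by (intro emeasure_eq_ennreal_measure) (auto simp: less_top)
    then show ?thesis
      using content_cbox_cart[OF ne] by simp
  qed
  have "ennreal ?E = (\<integral>\<^sup>+x. ennreal (exp (c \<bullet> x) - 1) * indicator (cbox a b) x + indicator (cbox a b) x \<partial>lborel)"
    unfolding nn_integral_exp_cbox[OF c ab, symmetric]
  proof (rule nn_integral_cong)
    fix x :: "real ^ 'n"
    show "ennreal (exp (c \<bullet> x)) * indicator (cbox a b) x
      = ennreal (exp (c \<bullet> x) - 1) * indicator (cbox a b) x + indicator (cbox a b) x"
      using ge[of x] ennreal_plus[of "exp (c \<bullet> x) - 1" 1] by (cases "x \<in> cbox a b") auto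
  qed
  also have "\<dots> = ?X + ennreal ?V"
    by (subst nn_integral_add) (auto simp: box)
  finally have E: "ennreal ?E = ?X + ennreal ?V" .
  have E0: "0 \<le> ?E" and V0: "0 \<le> ?V"
    using c ab by (auto intro!: prod_nonneg divide_nonneg_pos mult_left_mono simp: less_imp_le)
  have "ennreal ?V \<le> ennreal ?E"
    unfolding E by simp
  then have VE: "?V \<le> ?E"
    using E0 by (simp add: ennreal_le_iff)
  have "?X = ennreal ?E - ennreal ?V"
    unfolding E by simp
  also have "\<dots> = ennreal (?E - ?V)"
    using V0 by (simp add: ennreal_minus)
  finally have X: "emeasure lborel ?K = ennreal (?E - ?V)"
    by (subst emeasure_subgraph) auto
  have "?K \<in> sets borel"
    by (intro borel_subgraph) auto
  then have "measure lebesgue ?K = measure lborel ?K" by simp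
  also have "\<dots> = ?E - ?V"
    unfolding measure_def X using VE by simp
  finally show ?thesis .
qed

text \<open>
  The slice at \<open>z\<close> lies below \<open>exp (c \<bullet> x)\<close> over the box from \<open>z a\<close> to \<open>z b\<close>, so its volume is at
  most \<open>exp (z (c \<bullet> b))\<close> divided by the product of the \<open>c $ j\<close>. Integrating this over \<open>z \<in> [0, 1]\<close>
  gains the factor \<open>1 / (c \<bullet> b)\<close>.
\<close>

lemma measure_cone_under_exp_le:
  fixes a b c :: "real ^ 'n"
  assumes c: "\<forall>j. 0 < c $ j" and ab: "\<forall>j. a $ j \<le> b $ j" and L: "0 < c \<bullet> b"
    and meas: "cone_under (\<lambda>x. exp (c \<bullet> x) - 1) (cbox a b) \<in> lmeasurable"
  shows "measure lebesgue (cone_under (\<lambda>x. exp (c \<bullet> x) - 1) (cbox a b))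
     \<le> exp (c \<bullet> b) / ((c \<bullet> b) * (\<Prod>j\<in>UNIV. c $ j))"
proof -
  let ?L = "c \<bullet> b" and ?P = "\<Prod>j\<in>UNIV. c $ j"
  let ?S = "{(x, y::real). 0 \<le> y \<and> y < exp (c \<bullet> x)}"
  let ?B = "persp_cone (cbox a b \<times> UNIV) \<inter> {(x, y, z). 0 \<le> y \<and> y < exp (c \<bullet> x)}"
  have P: "0 < ?P" using c by (intro prod_pos) auto
  have "persp_cone (cbox a b \<times> (UNIV :: real set)) \<in> sets borel"
    by (intro persp_cone_borel borel_Times) auto
  moreover have "{(x::real^'n, y::real, z::real). 0 \<le> y \<and> y < exp (c \<bullet> x)} \<in> sets borel"
  proof -
    have "?S \<in> sets borel"
      using borel_subgraph[of UNIV "\<lambda>x. exp (c \<bullet> x)"] by simp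
    then have "(\<lambda>p::(real^'n) \<times> real \<times> real. (fst p, fst (snd p))) -` ?S \<in> sets borel"
      by (rule measurable_sets_borel[rotated]) (intro borel_measurable_continuous_onI continuous_intros)
    also have "(\<lambda>p::(real^'n) \<times> real \<times> real. (fst p, fst (snd p))) -` ?S = {(x, y, z). 0 \<le> y \<and> y < exp (c \<bullet> x)}"
      by auto
    finally show ?thesis .
  qed
  ultimately have B: "?B \<in> sets borel"
    by (rule sets.Int)
  have slice: "emeasure lborel {(x, y). (x, y, z) \<in> ?B} \<le> ennreal (exp (?L * z) / ?P) * indicator {0..1} z" for z :: real
  proof (cases "0 < z \<and> z \<le> 1")
    case True
    have le: "\<forall>j. (z *\<^sub>R a) $ j \<le> (z *\<^sub>R b) $ j"
      using ab True by (auto intro: mult_left_mono)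
    have "{(x, y). (x, y, z) \<in> ?B} = {(x, y). x \<in> cbox (z *\<^sub>R a) (z *\<^sub>R b) \<and> 0 \<le> y \<and> y < exp (c \<bullet> x)}"
      using True by (auto simp: persp_cone_def mem_box_cart field_simps)
    then have "emeasure lborel {(x, y). (x, y, z) \<in> ?B} =
       ennreal (\<Prod>j\<in>UNIV. (exp (c $ j * (z *\<^sub>R b) $ j) - exp (c $ j * (z *\<^sub>R a) $ j)) / c $ j)"
      using emeasure_subgraph[of "cbox (z *\<^sub>R a) (z *\<^sub>R b)" "\<lambda>x. exp (c \<bullet> x)"]
        nn_integral_exp_cbox[OF c le] by simp
    also have "\<dots> \<le> ennreal (\<Prod>j\<in>UNIV. exp (c $ j * (z *\<^sub>R b) $ j) / c $ j)"
      using c le by (intro ennreal_leI prod_mono conjI divide_nonneg_pos divide_right_mono)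
        (auto simp: less_imp_le intro!: mult_left_mono)
    also have "(\<Prod>j\<in>UNIV. exp (c $ j * (z *\<^sub>R b) $ j) / c $ j) = exp (?L * z) / ?P"
      by (simp add: prod_dividef exp_sum[symmetric] inner_vec_def sum_distrib_left mult.assoc mult.left_commute mult.commute)
    finally show ?thesis using True by simp
  next
    case False
    then have empty: "{(x, y). (x, y, z) \<in> ?B} = {}" by (auto simp: persp_cone_def)
    show ?thesis unfolding empty by simp
  qed
  have "emeasure lborel ?B \<le> (\<integral>\<^sup>+z. ennreal (exp (?L * z) / ?P) * indicator {0..1} z \<partial>lborel)"
    unfolding emeasure_lborel_slices_third[OF B] by (intro nn_integral_mono slice)
  also have "\<dots> = ennreal (exp (?L * 1) / (?L * ?P) - exp (?L * 0) / (?L * ?P))"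
    using L P by (intro nn_integral_FTC_Icc) (auto intro!: derivative_eq_intros simp: less_imp_neq[OF c[rule_format], symmetric])
  also have "\<dots> \<le> ennreal (exp ?L / (?L * ?P))"
    using L P by (intro ennreal_leI) simp
  finally have eB: "emeasure lborel ?B \<le> ennreal (exp ?L / (?L * ?P))" .
  have fB: "?B \<in> lmeasurable"
    using B le_less_trans[OF eB] by (intro fmeasurableI) auto
  have "measure lebesgue (cone_under (\<lambda>x. exp (c \<bullet> x) - 1) (cbox a b)) \<le> measure lebesgue ?B"
    using meas by (intro measure_mono_fmeasurable[OF _ _ fB]) (auto simp: cone_under_def persp_cone_def fmeasurableD)
  also have "\<dots> = measure lborel ?B" using B by simp
  also have "\<dots> \<le> exp ?L / (?L * ?P)"
    using eB L P unfolding measure_def by (intro enn2real_leI) auto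
  finally show ?thesis .
qed

text \<open>
  The region below \<open>h\<close> times the smallest of the coordinates \<open>(x $ j - a $ j) / s\<close> over the cube with
  lowest vertex \<open>a\<close> and side \<open>s\<close>, written without division or minimum. For \<open>s, h > 0\<close> the conditions
  \<open>a $ j \<le> x $ j\<close> follow from \<open>0 \<le> y\<close>.
\<close>

definition corner :: "real ^ 'n \<Rightarrow> real \<Rightarrow> real \<Rightarrow> ((real ^ 'n) \<times> real) set" where
  "corner a s h = {(x, y). 0 \<le> y \<and> (\<forall>j. h * (x $ j - a $ j) \<ge> s * y \<and> x $ j \<le> a $ j + s)}"

lemma corner_borel: "corner a s h \<in> sets borel"
proof -
  have "closed (corner a s h)"
    unfolding corner_def split_def
    by (intro closed_Collect_conj closed_Collect_all closed_Collect_le continuous_intros)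
  then show ?thesis by simp
qed

lemma lmeasurable_persp_cone_corner:
  fixes a :: "real ^ 'n"
  assumes "0 < s" "0 < h"
  shows "persp_cone (corner a s h) \<in> lmeasurable"
proof -
  have "corner a s h \<subseteq> cbox (a, 0) (a + s *\<^sub>R 1, h)"
  proof
    fix p assume "p \<in> corner a s h"
    then obtain x y where p: "p = (x, y)" and xy: "(x, y) \<in> corner a s h"
      by (cases p) auto
    then have y: "0 \<le> y" and lower: "s * y \<le> h * (x $ j - a $ j)" and upper: "x $ j - a $ j \<le> s" for j
      by (auto simp: corner_def algebra_simps)
    have "s * y \<le> h * (x $ undefined - a $ undefined)"
      by (rule lower)
    also have "\<dots> \<le> h * s"
      using upper assms by (intro mult_left_mono) auto
    finally have "y \<le> h"
      using assms by (simp add: mult.commute)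
    moreover have "a $ j \<le> x $ j" for j
    proof -
      have "0 \<le> h * (x $ j - a $ j)"
        using lower[of j] y assms by (meson less_imp_le mult_nonneg_nonneg order_trans)
      then show ?thesis using assms by (simp add: zero_le_mult_iff)
    qed
    ultimately show "p \<in> cbox (a, 0) (a + s *\<^sub>R 1, h)"
      using y upper assms by (auto simp: p cbox_Pair_eq mem_box_cart algebra_simps)
  qed
  then have "bounded (persp_cone (corner a s h))"
    by (intro bounded_persp_cone bounded_subset[OF bounded_cbox])
  then show ?thesis
    using persp_cone_borel[OF corner_borel]
    by (intro bounded_set_imp_lmeasurable sets_completionI_sets) simp_all
qed

lemma measure_corner:
  fixes a :: "real ^ 'n"
  assumes s: "0 < s" and h: "0 < h"
  shows "measure lebesgue (corner a s h) = s ^ CARD('n) * h / (real CARD('n) + 1)"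
proof -
  let ?n = "CARD('n)" and ?K = "corner a s h"
  have slice: "emeasure lborel ((\<lambda>x. (x, y)) -` ?K) = ennreal ((s * (1 - y / h)) ^ ?n) * indicator {0..h} y" for y
  proof -
    have *: "(\<lambda>x. (x, y)) -` ?K = (if 0 \<le> y then cbox (\<chi> j. a $ j + s * y / h) (\<chi> j. a $ j + s) else {})"
      using h by (auto simp: corner_def mem_box_cart field_simps)
    show ?thesis
    proof (cases "0 \<le> y \<and> y \<le> h")
      case True
      then have "s * y / h \<le> s" using s h by (simp add: field_simps)
      then have ne: "cbox (\<chi> j. a $ j + s * y / h) (\<chi> j. a $ j + s) \<noteq> {}"
        by (simp add: interval_ne_empty_cart)
      have "emeasure lborel (cbox (\<chi> j. a $ j + s * y / h) (\<chi> j. a $ j + s)) =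
         ennreal (measure lborel (cbox (\<chi> j. a $ j + s * y / h) (\<chi> j. a $ j + s)))"
        using emeasure_lborel_cbox_finite by (intro emeasure_eq_ennreal_measure) (auto simp: less_top)
      also have "measure lborel (cbox (\<chi> j. a $ j + s * y / h) (\<chi> j. a $ j + s)) = (s * (1 - y / h)) ^ ?n"
        using content_cbox_cart[OF ne] by (simp add: algebra_simps)
      finally show ?thesis using True * by simp
    next
      case False
      have "(\<lambda>x. (x, y)) -` ?K = {}"
      proof (cases "0 \<le> y")
        case True
        with False have "s < s * y / h" using s h by (simp add: field_simps)
        then show ?thesis
          unfolding * using True by (simp add: interval_eq_empty_cart)
      next
        case False
        then show ?thesis unfolding * by simp
      qed
      with False show ?thesis by simp
    qed
  qed
  have "?K \<in> sets (lborel \<Otimes>\<^sub>M lborel)"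
    using corner_borel by (simp only: lborel_prod sets_lborel)
  then have "emeasure lborel ?K = (\<integral>\<^sup>+y. emeasure lborel ((\<lambda>x. (x, y)) -` ?K) \<partial>lborel)"
    using lborel_pair.emeasure_pair_measure_alt2[of ?K] by (simp add: lborel_prod)
  also have "\<dots> = (\<integral>\<^sup>+y. ennreal ((s * (1 - y / h)) ^ ?n) * indicator {0..h} y \<partial>lborel)"
    by (simp only: slice)
  also have "\<dots> = ennreal (- (s ^ ?n * h / real (Suc ?n)) * (1 - h / h) ^ Suc ?n
      - - (s ^ ?n * h / real (Suc ?n)) * (1 - 0 / h) ^ Suc ?n)"
  proof (rule nn_integral_FTC_Icc)
    show "((\<lambda>y. - (s ^ ?n * h / real (Suc ?n)) * (1 - y / h) ^ Suc ?n)
       has_real_derivative (s * (1 - y / h)) ^ ?n) (at y)" for y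
      using h by (auto intro!: derivative_eq_intros simp del: of_nat_Suc power_Suc simp: power_mult_distrib)
  qed (use s h in \<open>auto intro!: zero_le_power mult_nonneg_nonneg simp: field_simps\<close>)
  finally have "emeasure lborel ?K = ennreal (s ^ ?n * h / (real ?n + 1))"
    using h by (simp add: add.commute)
  then have "measure lborel ?K = s ^ ?n * h / (real ?n + 1)"
    using s h by (simp add: measure_def)
  then show ?thesis
    using corner_borel[of a s h] by simp
qed

section \<open>The concave envelope of the exponential on a cube\<close>

lemma cube_image_eq_cbox:
  fixes v :: "real ^ 'n"
  assumes u: "0 < u"
  shows "(\<lambda>t. v + u *\<^sub>R t) ` {t. \<forall>j. 0 \<le> t $ j \<and> t $ j \<le> 1} = cbox v (v + u *\<^sub>R 1)"
proof (intro set_eqI iffI)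
  fix x assume "x \<in> (\<lambda>t. v + u *\<^sub>R t) ` {t. \<forall>j. 0 \<le> t $ j \<and> t $ j \<le> 1}"
  then show "x \<in> cbox v (v + u *\<^sub>R 1)"
    using u by (auto simp: mem_box_cart)
next
  fix x assume x: "x \<in> cbox v (v + u *\<^sub>R 1)"
  have "x = v + u *\<^sub>R ((x - v) /\<^sub>R u)"
    using u by simp
  moreover have "0 \<le> ((x - v) /\<^sub>R u) $ j \<and> ((x - v) /\<^sub>R u) $ j \<le> 1" for j
    using x u by (auto simp: mem_box_cart field_simps)
  ultimately show "x \<in> (\<lambda>t. v + u *\<^sub>R t) ` {t. \<forall>j. 0 \<le> t $ j \<and> t $ j \<le> 1}"
    by blast
qed

text \<open>
  A nonnegative concave function on the cube that is at least \<open>h\<close> at the top vertex dominates \<open>h\<close>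
  times the smallest relative coordinate.
\<close>

lemma corner_le_concave:
  fixes a :: "real ^ 'n"
  assumes g: "concave_on (cbox a (a + s *\<^sub>R 1)) g"
    and nonneg: "\<And>x. x \<in> cbox a (a + s *\<^sub>R 1) \<Longrightarrow> 0 \<le> g x"
    and top: "h \<le> g (a + s *\<^sub>R 1)" and s: "0 < s" and h: "0 < h"
    and xy: "(x, y) \<in> corner a s h"
  shows "x \<in> cbox a (a + s *\<^sub>R 1)" and "y \<le> g x"
proof -
  define l where "l = y / h"
  let ?t = "a + s *\<^sub>R 1"
  have y: "0 \<le> y" "y = l * h" and l0: "0 \<le> l"
    using xy h by (auto simp: corner_def l_def)
  have xj: "a $ j + s * l \<le> x $ j" "x $ j \<le> a $ j + s" for j
    using xy h by (auto simp: corner_def l_def field_simps)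
  have "s * l \<le> s * 1"
    using xj[of undefined] by simp
  then have l1: "l \<le> 1"
    using s by (simp only: mult_le_cancel_left_pos)
  have aj: "a $ j \<le> x $ j" for j
  proof -
    have "0 \<le> s * l" using s l0 by simp
    with xj(1)[of j] show ?thesis by linarith
  qed
  show xin: "x \<in> cbox a ?t"
    using xj aj by (simp add: mem_box_cart)
  show "y \<le> g x"
  proof (cases "l = 1")
    case True
    then have "x = ?t"
      using xj by (auto simp: vec_eq_iff intro: antisym)
    with True top y show ?thesis by simp
  next
    case False
    with l1 have l1: "l < 1" by simp
    \<comment> \<open>\<open>x\<close> splits into the top vertex with weight \<open>l\<close> and a point \<open>w\<close> of the cube.\<close>
    define w where "w = (x - l *\<^sub>R ?t) /\<^sub>R (1 - l)"
    have xw: "x = (1 - l) *\<^sub>R w + l *\<^sub>R ?t"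
      using l1 by (simp add: w_def)
    have "a $ j \<le> w $ j \<and> w $ j \<le> a $ j + s" for j
    proof -
      have "x $ j = (1 - l) * w $ j + l * (a $ j + s)"
        by (subst xw) simp
      with xj[of j] have "(1 - l) * (a $ j) \<le> (1 - l) * w $ j" "(1 - l) * w $ j \<le> (1 - l) * (a $ j + s)"
        by (simp_all add: algebra_simps)
      then show ?thesis
        using l1 by simp
    qed
    then have w: "w \<in> cbox a ?t"
      by (simp add: mem_box_cart)
    have t: "?t \<in> cbox a ?t"
      using s by (simp add: mem_box_cart)
    have "y \<le> l * g ?t"
      using y top l0 by (simp add: mult_left_mono)
    also have "\<dots> \<le> (1 - l) * g w + l * g ?t"
      using nonneg[OF w] l1 by simp
    also have "\<dots> \<le> g ((1 - l) *\<^sub>R w + l *\<^sub>R ?t)"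
    proof -
      have "0 \<le> 1 - l" "1 - l + l = 1" using l1 by auto
      then show ?thesis
        using g w t l0 unfolding concave_on_iff by blast
    qed
    also have "(1 - l) *\<^sub>R w + l *\<^sub>R ?t = x"
      by (rule xw[symmetric])
    finally show ?thesis .
  qed
qed

text \<open>
  Moving the other coordinates up to their maximum leaves an exponential in the relative coordinate
  \<open>t = (x $ j - v $ j) / u\<close> alone. Divided by its value at the top vertex it lies below the chord
  \<open>t + (1 - t) exp (- u c $ j)\<close>, here weakened to \<open>t + exp (- u c $ j)\<close>. Each \<open>j\<close> thus gives an
  affine majorant on the cube.
\<close>

lemma exp_le_affine:
  fixes c v x :: "real ^ 'n"
  assumes c: "\<forall>j. 0 < c $ j" and u: "0 < u" and x: "x \<in> cbox v (v + u *\<^sub>R 1)"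
  shows "exp (c \<bullet> x) \<le> exp (c \<bullet> (v + u *\<^sub>R 1)) * ((x $ j - v $ j) / u + exp (- (u * c $ j)))"
proof -
  define t where "t = (x $ j - v $ j) / u"
  have t: "0 \<le> t" "t \<le> 1" "x $ j = v $ j + u * t"
    using x u by (auto simp: t_def mem_box_cart field_simps)
  have "c $ j * (u * (1 - t)) \<le> (\<Sum>i\<in>UNIV. c $ i * ((v + u *\<^sub>R 1) $ i - x $ i))"
  proof -
    have "c $ j * ((v + u *\<^sub>R 1) $ j - x $ j) \<le> (\<Sum>i\<in>UNIV. c $ i * ((v + u *\<^sub>R 1) $ i - x $ i))"
      using c x by (intro member_le_sum) (auto simp: mem_box_cart less_imp_le)
    then show ?thesis using t by (simp add: algebra_simps)
  qed
  also have "\<dots> = c \<bullet> (v + u *\<^sub>R 1) - c \<bullet> x"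
    unfolding inner_diff_right[symmetric] by (simp add: inner_vec_def)
  finally have "c \<bullet> x \<le> c \<bullet> (v + u *\<^sub>R 1) + (1 - t) * (- (u * c $ j))"
    by (simp add: algebra_simps)
  then have "exp (c \<bullet> x) \<le> exp (c \<bullet> (v + u *\<^sub>R 1)) * exp ((1 - t) * (- (u * c $ j)))"
    by (simp flip: exp_add)
  also have "exp ((1 - t) * (- (u * c $ j))) \<le> t + (1 - t) * exp (- (u * c $ j))"
    using convex_onD[OF exp_convex, of "1 - t" 0 "- (u * c $ j)"] t by simp
  also have "\<dots> \<le> t + exp (- (u * c $ j))"
    using t by (simp add: mult_left_le_one_le)
  finally show ?thesis
    by (simp add: t_def)
qed

section \<open>Volume estimates and the limits\<close>

text \<open>
  For fixed \<open>u\<close>: the volume of the gap, equal for the two upper bounds, and the volumes of the two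
  naive relaxations in terms of the remainder \<open>b\<close>, exact for the constant bound and enclosed from
  both sides for the concave envelope. The constant \<open>M - 1\<close> is the maximum of \<open>f\<close> on \<open>Q\<close>, and \<open>E - u ^ n\<close> is the integral
  of \<open>f\<close> over \<open>Q\<close>.
\<close>

lemma volume_estimates:
  fixes c v :: "real ^ 'n"
  assumes c: "\<forall>j. 0 < c $ j" and v: "\<forall>j. 0 < v $ j" and u: "0 < u"
  defines "f \<equiv> \<lambda>x. exp (c \<bullet> x) - 1" and "Q \<equiv> cbox v (v + u *\<^sub>R 1)"
    and "M \<equiv> exp (c \<bullet> (v + u *\<^sub>R 1))" and "n \<equiv> CARD('n)"
    and "\<epsilon> \<equiv> (\<Sum>j\<in>UNIV. exp (- (u * c $ j)))"
    and "b \<equiv> measure lebesgue (cone_under (\<lambda>x. exp (c \<bullet> x) - 1) (cbox v (v + u *\<^sub>R 1)))"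
    and "E \<equiv> (\<Prod>j\<in>UNIV. (exp (c $ j * (v $ j + u)) - exp (c $ j * v $ j)) / c $ j)"
  shows exp_remainder_le: "b \<le> M / ((c \<bullet> (v + u *\<^sub>R 1)) * (\<Prod>j\<in>UNIV. c $ j))"
    and gap_const: "relaxation_gap f Q (\<lambda>x. M - 1) = (E - u ^ n) / (real n + 2) - b"
    and gap_conc: "relaxation_gap f Q (conc f Q) = (E - u ^ n) / (real n + 2) - b"
    and naive_const: "measure lebesgue (naive_relaxation f Q (\<lambda>x. M - 1)) = u ^ n * (M - 1) / (real n + 2) - b"
    and naive_conc_ge: "u ^ n * (M - 1) / ((real n + 1) * (real n + 2)) - b
        \<le> measure lebesgue (naive_relaxation f Q (conc f Q))"
    and naive_conc_le: "measure lebesgue (naive_relaxation f Q (conc f Q))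
        \<le> (u * (1 + \<epsilon>)) ^ n * (M * (1 + \<epsilon>)) / ((real n + 1) * (real n + 2))"
proof -
  let ?t = "v + u *\<^sub>R (1 :: real ^ 'n)"
  let ?L = "c \<bullet> ?t"
  have Q: "bounded Q" "Q \<noteq> {}" "convex Q" "?t \<in> Q"
    using u by (auto simp: Q_def bounded_cbox interval_ne_empty_cart mem_box_cart)
  have Qpos: "0 < x $ j" if "x \<in> Q" for x j
    using that v unfolding Q_def mem_box_cart by (meson less_le_trans)
  have inner_pos: "0 \<le> c \<bullet> (z *\<^sub>R q)" if "q \<in> Q" "0 \<le> z" for q z
    using that Qpos[OF that(1)] c by (auto simp: inner_vec_def less_imp_le intro!: sum_nonneg mult_nonneg_nonneg)
  have L: "0 < ?L"
    using c v u by (auto simp: inner_vec_def intro!: sum_pos mult_pos_pos add_pos_pos)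
  have f: "convex_on UNIV f" "f 0 = 0"
  proof -
    have "f ((1 - t) *\<^sub>R x + t *\<^sub>R y) \<le> (1 - t) * f x + t * f y" if "0 < t" "t < 1" for t x y
      using convex_onD[OF exp_convex, of t "c \<bullet> x" "c \<bullet> y"] that
      by (simp add: f_def inner_add_right algebra_simps)
    then show "convex_on UNIV f"
      by (intro convex_onI) auto
  qed (simp add: f_def)
  have nonneg: "0 \<le> f (z *\<^sub>R q)" if "q \<in> Q" "0 \<le> z" for q z
    using inner_pos[OF that] by (simp add: f_def)
  have fQ0: "0 \<le> f q" if "q \<in> Q" for q
    using nonneg[OF that, of 1] by simp
  have fM: "f q \<le> M - 1" if "q \<in> Q" for q
  proof -
    have "c \<bullet> q \<le> ?L"
      using that c unfolding Q_def inner_vec_def mem_box_cart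
      by (auto intro!: sum_mono mult_left_mono simp: less_imp_le)
    then show ?thesis by (simp add: f_def M_def)
  qed
  have M: "0 < M - 1"
    using L by (simp add: M_def)
  have const: "concave_on Q (\<lambda>x. M - 1)"
    unfolding concave_on_iff using Q(3) by (auto simp flip: distrib_right)
  have bdd: "bdd_above (f ` Q)"
    using fM by (auto intro!: bdd_aboveI)
  note conc = conc_smallest_concave_majorant[OF Q(3) bdd]
  have conc_ge: "f q \<le> conc f Q q" if "q \<in> Q" for q
    using conc(2) that by blast
  have conc_le: "conc f Q q \<le> M - 1" if "q \<in> Q" for q
    using conc(3)[OF const] fM that by blast
  let ?T = "\<lambda>\<mu>. persp_cone {(q, y). q \<in> Q \<and> 0 \<le> y \<and> y \<le> \<mu> q}"
  have b_eq: "b = measure lebesgue (cone_under f Q)"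
    by (simp add: b_def f_def Q_def)
  note vconst = relaxation_volumes[OF f nonneg Q(1,2) const fM order_refl, folded b_eq]
  note vconc = relaxation_volumes[OF f nonneg Q(1,2) conc(1) conc_ge conc_le, folded b_eq]

  have lm: "cone_under (\<lambda>x. exp (c \<bullet> x) - 1) (cbox v ?t) \<in> lmeasurable"
    using vconst(2) by (simp add: f_def Q_def)
  have b0: "0 \<le> b"
    by (simp add: b_def)
  from lm show "b \<le> M / (?L * (\<Prod>j\<in>UNIV. c $ j))"
    unfolding b_def M_def using c u L by (intro measure_cone_under_exp_le) auto

  have "measure lebesgue (persp_cone {(q, y). q \<in> Q \<and> 0 \<le> y \<and> y < f q}) = (E - u ^ n) / (real n + 2)"
  proof -
    have "{(q, y). q \<in> Q \<and> 0 \<le> y \<and> y < f q} \<in> sets borel"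
      unfolding f_def Q_def by (intro borel_subgraph) auto
    moreover have "measure lebesgue {(q, y). q \<in> Q \<and> 0 \<le> y \<and> y < f q} = E - u ^ n"
      unfolding f_def Q_def E_def n_def using u v
      by (subst measure_subgraph_exp[OF c]) (auto simp: less_imp_le)
    ultimately show ?thesis
      by (simp add: measure_persp_cone n_def)
  qed
  then show "relaxation_gap f Q (\<lambda>x. M - 1) = (E - u ^ n) / (real n + 2) - b"
    and "relaxation_gap f Q (conc f Q) = (E - u ^ n) / (real n + 2) - b"
    using vconst(4) vconc(4) by simp_all

  have "measure lebesgue (?T (\<lambda>x. M - 1)) = u ^ n * (M - 1) / (real n + 2)"
  proof -
    have "{(q, y). q \<in> Q \<and> 0 \<le> y \<and> y \<le> M - 1} = cbox (v, 0) (?t, M - 1)"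
      by (auto simp: Q_def cbox_Pair_eq)
    moreover have "measure lebesgue (cbox (v, 0) (?t, M - 1)) = u ^ n * (M - 1)"
      using M Q(2) by (simp add: content_Pair content_cbox_cart Q_def n_def)
    ultimately show ?thesis
      by (simp add: measure_persp_cone n_def)
  qed
  then show "measure lebesgue (naive_relaxation f Q (\<lambda>x. M - 1)) = u ^ n * (M - 1) / (real n + 2) - b"
    using vconst(3) by simp

  have "corner v u (M - 1) \<subseteq> {(q, y). q \<in> Q \<and> 0 \<le> y \<and> y \<le> conc f Q q}"
  proof clarify
    fix x y assume xy: "(x, y) \<in> corner v u (M - 1)"
    have top: "M - 1 \<le> conc f Q ?t"
      using conc_ge[OF Q(4)] by (simp add: f_def M_def)
    have nn: "0 \<le> conc f Q q" if "q \<in> Q" for q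
      using conc_ge[OF that] fQ0[OF that] by simp
    have "x \<in> Q"
      by (rule corner_le_concave(1)[of v u "conc f Q" "M - 1" x y, folded Q_def, OF conc(1) nn top u M xy])
    moreover have "y \<le> conc f Q x"
      by (rule corner_le_concave(2)[of v u "conc f Q" "M - 1" x y, folded Q_def, OF conc(1) nn top u M xy])
    ultimately show "x \<in> Q \<and> 0 \<le> y \<and> y \<le> conc f Q x"
      using xy by (simp add: corner_def)
  qed
  then have "measure lebesgue (persp_cone (corner v u (M - 1))) \<le> measure lebesgue (?T (conc f Q))"
    using corner_borel[of v u "M - 1"]
    by (intro measure_mono_fmeasurable[OF _ _ vconc(1)] persp_cone_mono) (auto simp: persp_cone_borel)
  then show "u ^ n * (M - 1) / ((real n + 1) * (real n + 2)) - b
        \<le> measure lebesgue (naive_relaxation f Q (conc f Q))"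
    using measure_corner[OF u M, of v] measure_persp_cone[OF corner_borel[of v u "M - 1"]] vconc(3)
    by (simp add: n_def)

  have eps: "exp (- (u * c $ j)) \<le> \<epsilon>" for j
    unfolding \<epsilon>_def by (rule member_le_sum) auto
  have eps0: "0 < \<epsilon>" unfolding \<epsilon>_def by (intro sum_pos) auto
  \<comment> \<open>Adding \<open>\<epsilon>\<close> to all relative coordinates is absorbed by moving the lowest vertex of the cube
    down by \<open>\<epsilon> u\<close>; the side and the height are then scaled by \<open>1 + \<epsilon>\<close> to keep the slope.\<close>
  let ?C = "corner (v - (\<epsilon> * u) *\<^sub>R 1) (u * (1 + \<epsilon>)) (M * (1 + \<epsilon>))"
  have "{(q, y). q \<in> Q \<and> 0 \<le> y \<and> y \<le> conc f Q q} \<subseteq> ?C"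
  proof clarify
    fix q y assume q: "q \<in> Q" and y: "0 \<le> y" "y \<le> conc f Q q"
    have "u * (1 + \<epsilon>) * y \<le> M * (1 + \<epsilon>) * (q $ j - (v - (\<epsilon> * u) *\<^sub>R 1) $ j)" for j
    proof -
      let ?h = "\<lambda>x. M * ((x $ j - v $ j) / u + exp (- (u * c $ j)))"
      have "concave_on Q ?h"
        unfolding concave_on_iff
      proof (intro conjI Q(3) ballI allI impI)
        fix x y and s t :: real assume "0 \<le> s" "0 \<le> t" and st: "s + t = 1"
        have t: "t = 1 - s" using st by simp
        show "s * ?h x + t * ?h y \<le> ?h (s *\<^sub>R x + t *\<^sub>R y)"
          unfolding t using u by (simp add: field_simps)
      qed
      moreover have "\<forall>x\<in>Q. f x \<le> ?h x"
      proof
        fix x assume "x \<in> Q"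
        then have "exp (c \<bullet> x) \<le> ?h x"
          unfolding Q_def M_def by (rule exp_le_affine[OF c u])
        then show "f x \<le> ?h x"
          unfolding f_def by linarith
      qed
      ultimately have "conc f Q q \<le> ?h q"
        by (rule bspec[OF conc(3) q])
      with y(2) have "y \<le> ?h q"
        by (rule order_trans)
      also have "\<dots> \<le> M * ((q $ j - v $ j) / u + \<epsilon>)"
        using M eps by (intro mult_left_mono) auto
      finally have "u * y \<le> M * (q $ j - v $ j + \<epsilon> * u)"
        using u by (simp add: field_simps)
      from mult_left_mono[OF this, of "1 + \<epsilon>"] show ?thesis
        using eps0 by (simp add: algebra_simps)
    qed
    moreover have "q $ j \<le> v $ j + u" for j
      using q by (simp add: Q_def mem_box_cart)
    ultimately show "(q, y) \<in> ?C"
      using y(1) by (simp add: corner_def algebra_simps)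
  qed
  moreover have "persp_cone ?C \<in> lmeasurable"
    using u M eps0 by (intro lmeasurable_persp_cone_corner) auto
  ultimately have "measure lebesgue (?T (conc f Q)) \<le> measure lebesgue (persp_cone ?C)"
    using vconc(1) by (intro measure_mono_fmeasurable persp_cone_mono) (auto intro: fmeasurableD)
  also have "\<dots> = (u * (1 + \<epsilon>)) ^ n * (M * (1 + \<epsilon>)) / ((real n + 1) * (real n + 2))"
    using u M eps0
      measure_persp_cone[OF corner_borel[of "v - (\<epsilon> * u) *\<^sub>R 1" "u * (1 + \<epsilon>)" "M * (1 + \<epsilon>)"]]
      measure_corner[of "u * (1 + \<epsilon>)" "M * (1 + \<epsilon>)" "v - (\<epsilon> * u) *\<^sub>R 1"]
    by (simp add: n_def)
  finally show "measure lebesgue (naive_relaxation f Q (conc f Q)) \<le> \<dots>"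
    using vconc(3) b0 by linarith
qed

theorem theorem4p4:
  fixes c v0 :: "real ^ 'n"
    and f :: "real ^ 'n \<Rightarrow> real"
    and Q :: "real \<Rightarrow> (real ^ 'n) set"
    and F :: "real \<Rightarrow> real"
  assumes c_pos: "\<forall>j. 0 < c $ j"
    and v0_pos: "\<forall>j. 0 < v0 $ j"
  defines "f \<equiv> \<lambda>x. exp (c \<bullet> x) - 1"
    and "Q \<equiv> \<lambda>u. (\<lambda>t. v0 + u *\<^sub>R t) ` {t. \<forall>j. 0 \<le> t $ j \<and> t $ j \<le> 1}"
    and "F \<equiv> \<lambda>u. SUP x\<in>Q u. f x"
  shows "(\<forall>u>0. v0 + u *\<^sub>R 1 \<in> Q u \<and> (\<forall>x\<in>Q u. f x \<le> F u) \<and>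
                F u = f (v0 + u *\<^sub>R 1) \<and> F u = exp (c \<bullet> v0) * exp (u * (c \<bullet> 1)) - 1) \<and>
    ((\<lambda>u. u ^ CARD('n) *
          (relaxation_gap f (Q u) (conc f (Q u)) /
           measure lebesgue (naive_relaxation f (Q u) (conc f (Q u)))))
      \<longlongrightarrow> (real CARD('n) + 1) / (\<Prod>j\<in>UNIV. c $ j)) at_top \<and>
    ((\<lambda>u. u ^ CARD('n) *
          ((real CARD('n) + 1) * relaxation_gap f (Q u) (\<lambda>x. F u) /
           measure lebesgue (naive_relaxation f (Q u) (\<lambda>x. F u))))
      \<longlongrightarrow> (real CARD('n) + 1) / (\<Prod>j\<in>UNIV. c $ j)) at_top"
proof -
  define n where "n = CARD('n)"
  define P where "P = (\<Prod>j\<in>UNIV. c $ j)"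
  define k where "k = c \<bullet> (1 :: real ^ 'n)"
  define M where "M u = exp (c \<bullet> (v0 + u *\<^sub>R 1))" for u
  define L where "L u = c \<bullet> (v0 + u *\<^sub>R 1)" for u
  define \<epsilon> where "\<epsilon> u = (\<Sum>j\<in>UNIV. exp (- (u * c $ j)))" for u
  define b where "b u = measure lebesgue (cone_under (\<lambda>x. exp (c \<bullet> x) - 1) (cbox v0 (v0 + u *\<^sub>R 1)))" for u
  define E where "E u = (\<Prod>j\<in>UNIV. (exp (c $ j * (v0 $ j + u)) - exp (c $ j * v0 $ j)) / c $ j)" for u
  \<comment> \<open>\<open>G\<close> is the gap, \<open>N\<close> and \<open>NF\<close> (below) are the volumes of the naive relaxations.\<close>
  define G where "G u = (E u - u ^ n) / (real n + 2) - b u" for u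
  have P: "0 < P" using c_pos by (auto simp: P_def intro!: prod_pos)
  have k: "0 < k" using c_pos by (auto simp: k_def inner_vec_def intro!: sum_pos)
  have cv: "0 < c \<bullet> v0" using c_pos v0_pos by (auto simp: inner_vec_def intro!: sum_pos mult_pos_pos)
  have Q_eq: "Q u = cbox v0 (v0 + u *\<^sub>R 1)" if "0 < u" for u
    unfolding Q_def by (rule cube_image_eq_cbox[OF that])
  have L_eq: "L u = c \<bullet> v0 + k * u" for u
    by (simp add: L_def k_def inner_add_right)
  have M_eq: "M u = exp (c \<bullet> v0) * exp (u * k)" for u
    using L_eq[of u] by (simp add: L_def M_def exp_add mult.commute)
  have M0: "0 < M u" for u by (simp add: M_def)

  have first: "v0 + u *\<^sub>R 1 \<in> Q u \<and> (\<forall>x\<in>Q u. f x \<le> F u) \<and> F u = f (v0 + u *\<^sub>R 1)" and FM: "F u = M u - 1"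
    if u: "0 < u" for u
  proof -
    have t: "v0 + u *\<^sub>R 1 \<in> Q u"
      using u by (simp add: Q_eq mem_box_cart)
    have le: "f x \<le> f (v0 + u *\<^sub>R 1)" if "x \<in> Q u" for x
    proof -
      have "c \<bullet> x \<le> c \<bullet> (v0 + u *\<^sub>R 1)"
        using that c_pos unfolding Q_eq[OF u] inner_vec_def mem_box_cart
        by (auto intro!: sum_mono mult_left_mono simp: less_imp_le)
      then show ?thesis by (simp add: f_def)
    qed
    have eq: "F u = f (v0 + u *\<^sub>R 1)"
      unfolding F_def using t le by (intro cSup_eq_maximum) auto
    show "v0 + u *\<^sub>R 1 \<in> Q u \<and> (\<forall>x\<in>Q u. f x \<le> F u) \<and> F u = f (v0 + u *\<^sub>R 1)"
      using t le eq by auto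
    show "F u = M u - 1"
      by (simp add: eq f_def M_def)
  qed

  have b0: "0 \<le> b u" for u by (simp add: b_def)
  have b_le: "b u \<le> M u / (L u * P)" if "0 < u" for u
    using exp_remainder_le[OF c_pos v0_pos that] by (simp add: b_def M_def L_def P_def)
  have gapF: "relaxation_gap f (Q u) (\<lambda>x. F u) = G u" if "0 < u" for u
    using gap_const[OF c_pos v0_pos that] that
    by (simp add: FM Q_eq G_def b_def E_def f_def M_def n_def)
  have gapC: "relaxation_gap f (Q u) (conc f (Q u)) = G u" if "0 < u" for u
    using gap_conc[OF c_pos v0_pos that] that
    by (simp add: Q_eq G_def b_def E_def f_def M_def n_def)
  define N where "N u = measure lebesgue (naive_relaxation f (Q u) (conc f (Q u)))" for u
  define NF where "NF u = measure lebesgue (naive_relaxation f (Q u) (\<lambda>x. F u))" for u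
  have NF: "NF u = u ^ n * (M u - 1) / (real n + 2) - b u" if "0 < u" for u
    using naive_const[OF c_pos v0_pos that] that
    by (simp add: NF_def FM Q_eq b_def f_def M_def n_def)
  have N_ge: "u ^ n * (M u - 1) / ((real n + 1) * (real n + 2)) - b u \<le> N u" if "0 < u" for u
    using naive_conc_ge[OF c_pos v0_pos that] that
    by (simp add: N_def Q_eq b_def f_def M_def n_def)
  have N_le: "N u \<le> (u * (1 + \<epsilon> u)) ^ n * (M u * (1 + \<epsilon> u)) / ((real n + 1) * (real n + 2))" if "0 < u" for u
    using naive_conc_le[OF c_pos v0_pos that] that
    by (simp add: N_def Q_eq f_def M_def n_def \<epsilon>_def)

  have linear: "filterlim (\<lambda>u. a * u) at_top at_top" if "0 < a" for a :: real
    by (rule filterlim_tendsto_pos_mult_at_top[OF tendsto_const that filterlim_ident])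
  have exp0: "((\<lambda>u. exp (- (u * a))) \<longlongrightarrow> 0) at_top" if "0 < a" for a :: real
    using linear[OF that]
    by (intro filterlim_compose[OF exp_at_bot]) (simp add: filterlim_uminus_at_top mult.commute)
  have lim_invM: "((\<lambda>u. 1 / M u) \<longlongrightarrow> 0) at_top"
    using tendsto_mult_left[OF exp0[OF k], of "exp (- (c \<bullet> v0))"]
    by (simp add: M_eq exp_minus divide_inverse)
  have lim_powM: "((\<lambda>u. u ^ n / M u) \<longlongrightarrow> 0) at_top"
  proof -
    have "((\<lambda>u. (k * u) ^ n / exp (k * u)) \<longlongrightarrow> 0) at_top"
      by (rule filterlim_compose[OF tendsto_power_div_exp_0 linear[OF k]])
    then have "((\<lambda>u. exp (- (c \<bullet> v0)) / k ^ n * ((k * u) ^ n / exp (k * u))) \<longlongrightarrow> 0) at_top"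
      by (rule tendsto_mult_right_zero)
    moreover have "exp (- (c \<bullet> v0)) / k ^ n * ((k * u) ^ n / exp (k * u)) = u ^ n / M u" for u
      using k by (simp add: M_eq exp_minus power_mult_distrib mult.commute field_simps)
    ultimately show ?thesis by simp
  qed
  have lim_b: "((\<lambda>u. b u / M u) \<longlongrightarrow> 0) at_top"
  proof (rule tendsto_sandwich)
    show "\<forall>\<^sub>F u in at_top. 0 \<le> b u / M u"
      using b0 M0 by (simp add: less_imp_le)
    show "\<forall>\<^sub>F u in at_top. b u / M u \<le> 1 / (L u * P)"
      using eventually_gt_at_top[of 0]
    proof eventually_elim
      case (elim u)
      from divide_right_mono[OF b_le[OF elim], of "M u"] show ?case
        using M0[of u] by simp
    qed
    have "filterlim L at_top at_top"
      unfolding L_eq[abs_def] by (rule filterlim_tendsto_add_at_top[OF tendsto_const linear[OF k]])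
    then have "filterlim (\<lambda>u. L u * P) at_top at_top"
      by (rule filterlim_at_top_mult_tendsto_pos[OF tendsto_const P])
    then show "((\<lambda>u. 1 / (L u * P)) \<longlongrightarrow> 0) at_top"
      by (intro tendsto_divide_0[OF tendsto_const] filterlim_at_top_imp_at_infinity)
  qed simp
  have lim_b': "((\<lambda>u. b u / (M u * u ^ n)) \<longlongrightarrow> 0) at_top"
  proof (rule tendsto_sandwich[OF _ _ tendsto_const lim_b])
    show "\<forall>\<^sub>F u in at_top. 0 \<le> b u / (M u * u ^ n)"
      using eventually_gt_at_top[of 0] by eventually_elim (auto simp: b0 M0 less_imp_le)
    show "\<forall>\<^sub>F u in at_top. b u / (M u * u ^ n) \<le> b u / M u"
      using eventually_ge_at_top[of 1]
    proof eventually_elim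
      case (elim u)
      then have "M u * 1 \<le> M u * u ^ n"
        using M0[of u] by (intro mult_left_mono one_le_power) auto
      then show ?case
        using b0[of u] M0[of u] elim by (intro divide_left_mono) auto
    qed
  qed
  have lim_eps: "(\<epsilon> \<longlongrightarrow> 0) at_top"
    unfolding \<epsilon>_def[abs_def] using tendsto_sum[of UNIV "\<lambda>j u. exp (- (u * c $ j))" "\<lambda>j. 0"] exp0 c_pos by simp
  have E_eq: "E u / M u = (\<Prod>j\<in>UNIV. (1 - exp (- (u * c $ j))) / c $ j)" for u
  proof -
    have "M u = (\<Prod>j\<in>UNIV. exp (c $ j * (v0 $ j + u)))"
      by (simp add: M_def inner_vec_def exp_sum)
    then have "E u / M u = (\<Prod>j\<in>UNIV. (exp (c $ j * (v0 $ j + u)) - exp (c $ j * v0 $ j)) / c $ j / exp (c $ j * (v0 $ j + u)))"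
      by (simp only: E_def prod_dividef)
    also have "\<dots> = (\<Prod>j\<in>UNIV. (1 - exp (- (u * c $ j))) / c $ j)"
    proof (intro prod.cong refl)
      fix j
      have "exp (- (u * c $ j)) = exp (c $ j * v0 $ j) / exp (c $ j * (v0 $ j + u))"
        by (simp add: algebra_simps flip: exp_diff)
      then show "(exp (c $ j * (v0 $ j + u)) - exp (c $ j * v0 $ j)) / c $ j / exp (c $ j * (v0 $ j + u))
          = (1 - exp (- (u * c $ j))) / c $ j"
        by (simp add: diff_divide_distrib mult.commute)
    qed
    finally show ?thesis .
  qed
  have lim_E: "((\<lambda>u. E u / M u) \<longlongrightarrow> 1 / P) at_top"
  proof -
    have "((\<lambda>u. \<Prod>j\<in>UNIV. (1 - exp (- (u * c $ j))) / c $ j) \<longlongrightarrow> (\<Prod>j\<in>UNIV. (1 - 0) / c $ j)) at_top"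
      using c_pos by (intro tendsto_intros exp0) (auto simp: less_imp_neq[symmetric])
    then show ?thesis
      unfolding E_eq by (simp add: P_def prod_dividef)
  qed
  have lim_G: "((\<lambda>u. G u / M u) \<longlongrightarrow> 1 / P / (real n + 2)) at_top"
  proof -
    have "((\<lambda>u. (E u / M u - u ^ n / M u) / (real n + 2) - b u / M u) \<longlongrightarrow> (1 / P - 0) / (real n + 2) - 0) at_top"
      by (intro tendsto_intros lim_E lim_powM lim_b) auto
    then show ?thesis
      by (simp add: G_def diff_divide_distrib divide_divide_eq_left mult.commute)
  qed
  \<comment> \<open>Both the exact volume \<open>NF\<close> and the lower bound of \<open>N\<close> have the form on the left.\<close>
  have shape: "(u ^ n * (M u - 1) / q - b u) / (M u * u ^ n) = (1 - 1 / M u) / q - b u / (M u * u ^ n)"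
    if "0 < u" for u q
  proof -
    have "u ^ n * (M u - 1) / q / (M u * u ^ n) = (M u - 1) / M u / q"
      using that by simp
    also have "(M u - 1) / M u = 1 - 1 / M u"
      using M0[of u] by (simp add: diff_divide_distrib)
    finally show ?thesis by (simp add: diff_divide_distrib)
  qed
  have lower: "((\<lambda>u. (1 - 1 / M u) / q - b u / (M u * u ^ n)) \<longlongrightarrow> 1 / q) at_top" if "q \<noteq> 0" for q
    using tendsto_diff[OF tendsto_divide[OF tendsto_diff[OF tendsto_const[of 1] lim_invM] tendsto_const that] lim_b'] by simp
  have lim_NF: "((\<lambda>u. NF u / (M u * u ^ n)) \<longlongrightarrow> 1 / (real n + 2)) at_top"
  proof (rule Lim_transform_eventually[OF lower])
    show "\<forall>\<^sub>F u in at_top. (1 - 1 / M u) / (real n + 2) - b u / (M u * u ^ n) = NF u / (M u * u ^ n)"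
      using eventually_gt_at_top[of 0] by eventually_elim (simp add: NF shape)
  qed simp
  have lim_N: "((\<lambda>u. N u / (M u * u ^ n)) \<longlongrightarrow> 1 / ((real n + 1) * (real n + 2))) at_top"
  proof (rule tendsto_sandwich)
    let ?q = "(real n + 1) * (real n + 2)"
    show "((\<lambda>u. (1 - 1 / M u) / ?q - b u / (M u * u ^ n)) \<longlongrightarrow> 1 / ?q) at_top"
      by (rule lower) simp
    show "\<forall>\<^sub>F u in at_top. (1 - 1 / M u) / ?q - b u / (M u * u ^ n) \<le> N u / (M u * u ^ n)"
      using eventually_gt_at_top[of 0]
    proof eventually_elim
      case (elim u)
      then show ?case
        unfolding shape[OF elim, symmetric] using N_ge[OF elim] M0[of u] by (intro divide_right_mono) auto
    qed
    show "\<forall>\<^sub>F u in at_top. N u / (M u * u ^ n) \<le> (1 + \<epsilon> u) ^ n * (1 + \<epsilon> u) / ?q"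
      using eventually_gt_at_top[of 0]
    proof eventually_elim
      case (elim u)
      have "N u / (M u * u ^ n) \<le> (u * (1 + \<epsilon> u)) ^ n * (M u * (1 + \<epsilon> u)) / ?q / (M u * u ^ n)"
        using N_le[OF elim] M0[of u] elim by (intro divide_right_mono) auto
      also have "\<dots> = (1 + \<epsilon> u) ^ n * (1 + \<epsilon> u) / ?q"
        using M0[of u] elim by (simp add: power_mult_distrib)
      finally show ?case .
    qed
    have "((\<lambda>u. (1 + \<epsilon> u) ^ n * (1 + \<epsilon> u) / ?q) \<longlongrightarrow> (1 + 0) ^ n * (1 + 0) / ?q) at_top"
      by (intro tendsto_intros lim_eps) auto
    then show "((\<lambda>u. (1 + \<epsilon> u) ^ n * (1 + \<epsilon> u) / ?q) \<longlongrightarrow> 1 / ?q) at_top"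
      by simp
  qed
  have "((\<lambda>u. (G u / M u) / (N u / (M u * u ^ n))) \<longlongrightarrow> (1 / P / (real n + 2)) / (1 / ((real n + 1) * (real n + 2)))) at_top"
    by (intro tendsto_divide lim_G lim_N) auto
  also have "(1 / P / (real n + 2)) / (1 / ((real n + 1) * (real n + 2))) = (real n + 1) / P"
  proof -
    have "(1 / P / q) / (1 / (r * q)) = r / P" if "0 < q" for q r
      using that by simp
    from this[of "real n + 2" "real n + 1"] show ?thesis by simp
  qed
  finally have limC: "((\<lambda>u. u ^ n * (relaxation_gap f (Q u) (conc f (Q u)) / N u)) \<longlongrightarrow> (real n + 1) / P) at_top"
  proof (rule Lim_transform_eventually)
    show "\<forall>\<^sub>F u in at_top. (G u / M u) / (N u / (M u * u ^ n)) = u ^ n * (relaxation_gap f (Q u) (conc f (Q u)) / N u)"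
      using eventually_gt_at_top[of 0] by eventually_elim (simp add: gapC M0 less_imp_neq[OF M0, symmetric])
  qed
  have "((\<lambda>u. (real n + 1) * ((G u / M u) / (NF u / (M u * u ^ n)))) \<longlongrightarrow> (real n + 1) * ((1 / P / (real n + 2)) / (1 / (real n + 2)))) at_top"
    by (intro tendsto_mult tendsto_const tendsto_divide lim_G lim_NF) auto
  also have "(real n + 1) * ((1 / P / (real n + 2)) / (1 / (real n + 2))) = (real n + 1) / P"
  proof -
    have "r * (1 / P / q / (1 / q)) = r / P" if "0 < q" for q r
      using that by simp
    from this[of "real n + 2" "real n + 1"] show ?thesis by simp
  qed
  finally have limF: "((\<lambda>u. u ^ n * ((real n + 1) * relaxation_gap f (Q u) (\<lambda>x. F u) / NF u)) \<longlongrightarrow> (real n + 1) / P) at_top"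
  proof (rule Lim_transform_eventually)
    show "\<forall>\<^sub>F u in at_top. (real n + 1) * ((G u / M u) / (NF u / (M u * u ^ n))) =
       u ^ n * ((real n + 1) * relaxation_gap f (Q u) (\<lambda>x. F u) / NF u)"
      using eventually_gt_at_top[of 0] by eventually_elim (simp add: gapF M0 less_imp_neq[OF M0, symmetric])
  qed
  have maxF: "\<forall>u>0. v0 + u *\<^sub>R 1 \<in> Q u \<and> (\<forall>x\<in>Q u. f x \<le> F u) \<and>
      F u = f (v0 + u *\<^sub>R 1) \<and> F u = exp (c \<bullet> v0) * exp (u * (c \<bullet> 1)) - 1"
  proof (intro allI impI)
    fix u :: real assume u: "0 < u"
    have "F u = exp (c \<bullet> v0) * exp (u * (c \<bullet> 1)) - 1"
      by (simp add: FM[OF u] M_eq k_def)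
    with first[OF u] show "v0 + u *\<^sub>R 1 \<in> Q u \<and> (\<forall>x\<in>Q u. f x \<le> F u) \<and>
        F u = f (v0 + u *\<^sub>R 1) \<and> F u = exp (c \<bullet> v0) * exp (u * (c \<bullet> 1)) - 1"
      by blast
  qed
  show ?thesis
    using maxF limC limF unfolding n_def P_def N_def NF_def by blast
qed

end
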